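(* Let $0<\alpha<1$ and let $\Phi:\mathbb{R}\to\mathbb{R}$ be given by $$\Phi(w)=\begin{cases}\frac{1}{\sqrt{2\pi}} & 0\le |w|<(1-\alpha)\pi,\\ \frac{1}{\sqrt{2\pi}}\cos\left(\frac{1}{4\alpha}\big(|w|-(1-\alpha)\pi\big)\right) & (1-\alpha)\pi\le |w|<(1+\alpha)\pi,\\ 0 & |w|\ge (1+\alpha)\pi.\end{cases}$$ Then its inverse Fourier transform $\phi^{(deO)}(t)=\frac{1}{2\pi}\int_{-\infty}^{+\infty}\Phi(w)e^{jwt}\,dw$ is given, for every real $t\neq\pm\frac{1}{4\alpha}$, by $$\phi^{(deO)}(t)=\frac{1}{\sqrt{2\pi}}(1-\alpha)\,\mathrm{Sinc}[(1-\alpha)t]+\frac{1}{\sqrt{2\pi}}\cdot\frac{4\alpha}{\pi}\cdot\frac{1}{1-(4\alpha t)^2}\left\{\cos\pi(1+\alpha)t+4\alpha t\,\sin\pi(1-\alpha)t\right\}.$$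
   Context: $j$ is the imaginary unit. $\mathrm{Sinc}(t):=\frac{\sin(\pi t)}{\pi t}$ for $t\ne 0$, and $\mathrm{Sinc}(0):=1$. The function $\phi^{(deO)}$ is called the "de Oliveira" scaling function with roll-off $\alpha$. *)

theory Defs
  imports "HOL-Analysis.Analysis"
begin

(* The normalised cardinal sine; HOL-Probability.Sinc_Integral has only the unnormalised sin x / x. *)
definition Sinc :: "real \<Rightarrow> real" where
  "Sinc t = (if t = 0 then 1 else sin (pi * t) / (pi * t))"

(* Normalised by 1 / (2 pi), with kernel exp (i w t); a Lebesgue integral over the real line. *)
definition inverse_fourier :: "(real \<Rightarrow> real) \<Rightarrow> real \<Rightarrow> complex" where
  "inverse_fourier f t =
     1 / (2 * complex_of_real pi) *
     (LINT w|lborel. complex_of_real (f w) * exp (\<i> * complex_of_real (w * t)))"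

definition deO_spectrum :: "real \<Rightarrow> real \<Rightarrow> real" where
  "deO_spectrum \<alpha> w =
     (if \<bar>w\<bar> < (1 - \<alpha>) * pi then 1 / sqrt (2 * pi)
      else if \<bar>w\<bar> < (1 + \<alpha>) * pi
        then 1 / sqrt (2 * pi) * cos (1 / (4 * \<alpha>) * (\<bar>w\<bar> - (1 - \<alpha>) * pi))
      else 0)"

definition deO_scaling :: "real \<Rightarrow> real \<Rightarrow> complex" where
  "deO_scaling \<alpha> = inverse_fourier (deO_spectrum \<alpha>)"

end

(* Since the spectrum is even, only the cosine part of the kernel survives, integrated over
   [0, (1 + alpha) pi]. On that interval the spectrum is the continuous function
   cos (max 0 (w - (1 - alpha) pi) / (4 alpha)) / sqrt (2 pi); the flat part contributes the Sinc term
   and the roll-off part has an elementary antiderivative. *)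
theory Submission
  imports Defs
begin

lemma has_integral_cos_Sinc:
  assumes "0 < a"
  shows "((\<lambda>w. cos (w * t)) has_integral a * pi * Sinc (a * t)) {0..a * pi}"
proof (cases "t = 0")
  case True
  then show ?thesis
    using has_integral_const_real[of "1::real" 0 "a * pi"] assms by (simp add: Sinc_def)
next
  case False
  have "((\<lambda>w. cos (w * t)) has_integral sin (a * pi * t) / t - sin (0 * t) / t) {0..a * pi}"
    using assms False
    by (intro fundamental_theorem_of_calculus)
       (auto intro!: derivative_eq_intros simp flip: has_real_derivative_iff_has_vector_derivative)
  moreover have "sin (a * pi * t) / t - sin (0 * t) / t = a * pi * Sinc (a * t)"
    using assms False by (simp add: Sinc_def mult_ac)
  ultimately show ?thesis by simp
qed

text \<open>\<open>G\<close> is what integrating by parts twice yields: differentiating its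
  numerator produces two mixed sine products that cancel, leaving the factor
  \<open>c\<^sup>2 - t\<^sup>2\<close> times the integrand. The hypothesis on \<open>c\<close> and
  \<open>t\<close> excludes resonance, where the two frequencies coincide up to sign.\<close>

lemma has_integral_cos_mult_cos:
  fixes a b c s t :: real
  assumes "a \<le> b" and "c\<^sup>2 \<noteq> t\<^sup>2"
  defines "G \<equiv> \<lambda>w. (c * sin (c * (w - s)) * cos (w * t) - t * cos (c * (w - s)) * sin (w * t))
    / (c\<^sup>2 - t\<^sup>2)"
  shows "((\<lambda>w. cos (c * (w - s)) * cos (w * t)) has_integral (G b - G a)) {a..b}"
proof (rule fundamental_theorem_of_calculus[OF assms(1)])
  fix w
  have nz: "c\<^sup>2 - t\<^sup>2 \<noteq> 0"
    using assms(2) by simp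
  have "(G has_real_derivative
      ((c\<^sup>2 - t\<^sup>2) * (cos (c * (w - s)) * cos (w * t))) / (c\<^sup>2 - t\<^sup>2)) (at w within {a..b})"
    unfolding G_def
    by (rule DERIV_cdivide) (auto intro!: derivative_eq_intros simp: algebra_simps power2_eq_square)
  then show "(G has_vector_derivative cos (c * (w - s)) * cos (w * t)) (at w within {a..b})"
    using nz by (simp add: has_real_derivative_iff_has_vector_derivative)
qed

lemma deO_spectrum_minus [simp]: "deO_spectrum \<alpha> (- w) = deO_spectrum \<alpha> w"
  by (simp add: deO_spectrum_def)

text \<open>This trades the piecewise spectrum for a continuous function on a compact interval,
  which gives integrability and lets the integral be split. The interval may be closed because the
  roll-off phase reaches pi / 2 at its right end, where the cosine vanishes just as the spectrum
  does.\<close>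

lemma deO_spectrum_half_line:
  assumes "0 < \<alpha>" and "\<alpha> < 1"
  shows "indicator {0..} w *\<^sub>R (deO_spectrum \<alpha> w * g w) =
    indicator {0..(1 + \<alpha>) * pi} w *\<^sub>R
      (1 / sqrt (2 * pi) * cos (1 / (4 * \<alpha>) * max 0 (w - (1 - \<alpha>) * pi)) * g w)"
proof -
  have le: "(1 - \<alpha>) * pi < (1 + \<alpha>) * pi"
    using assms by simp
  have "1 / (4 * \<alpha>) * ((1 + \<alpha>) * pi - (1 - \<alpha>) * pi) = pi / 2"
    using assms by (simp add: field_simps)
  then have end0: "cos (1 / (4 * \<alpha>) * ((1 + \<alpha>) * pi - (1 - \<alpha>) * pi)) = 0"
    by (simp only: cos_pi_half)
  consider "w < 0" | "0 \<le> w" "w < (1 - \<alpha>) * pi" | "(1 - \<alpha>) * pi \<le> w" "0 \<le> w" "w < (1 + \<alpha>) * pi"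
    | "w = (1 + \<alpha>) * pi" | "0 \<le> w" "(1 + \<alpha>) * pi < w"
    by linarith
  then show ?thesis
  proof cases
    case 4
    then have "max 0 (w - (1 - \<alpha>) * pi) = (1 + \<alpha>) * pi - (1 - \<alpha>) * pi" and "0 \<le> w"
      using le assms by simp_all
    then show ?thesis
      using 4 le end0 by (simp only:) (simp add: deO_spectrum_def)
  qed (use less_trans[of w, OF _ le] less_trans[OF le, of w]
      in \<open>auto simp: deO_spectrum_def indicator_def max_def\<close>)
qed

lemma integrable_deO_spectrum_half_line:
  assumes "0 < \<alpha>" and "\<alpha> < 1" and "continuous_on UNIV g"
  shows "integrable lborel (\<lambda>w. indicator {0..} w *\<^sub>R (deO_spectrum \<alpha> w * g w :: real))"
  unfolding deO_spectrum_half_line[OF assms(1,2)]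
  by (intro borel_integrable_compact continuous_intros continuous_on_subset[OF assms(3)]) auto

text \<open>The antiderivative is used with \<open>c\<close> = 1 / (4 \<alpha>), so the excluded
  values of \<open>t\<close> are the resonances. The phase runs from 0 to pi / 2, so each endpoint
  keeps one term: the cosine comes from the upper one, the sine from the lower one.\<close>

lemma has_integral_rolloff:
  fixes \<alpha> t :: real
  assumes "0 < \<alpha>" and "t \<noteq> 1 / (4 * \<alpha>)" and "t \<noteq> - (1 / (4 * \<alpha>))"
  shows "((\<lambda>w. cos (1 / (4 * \<alpha>) * (w - (1 - \<alpha>) * pi)) * cos (w * t)) has_integral
    4 * \<alpha> / (1 - (4 * \<alpha> * t)\<^sup>2) * (cos (pi * (1 + \<alpha>) * t) + 4 * \<alpha> * t * sin (pi * (1 - \<alpha>) * t)))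
    {(1 - \<alpha>) * pi..(1 + \<alpha>) * pi}"
proof -
  define c where "c = 1 / (4 * \<alpha>)"
  have ne: "c\<^sup>2 \<noteq> t\<^sup>2"
    using assms by (auto simp: power2_eq_iff c_def)
  have "c * ((1 + \<alpha>) * pi - (1 - \<alpha>) * pi) = pi / 2"
    using assms by (simp add: c_def field_simps)
  then have ends: "sin (c * ((1 + \<alpha>) * pi - (1 - \<alpha>) * pi)) = 1"
      "cos (c * ((1 + \<alpha>) * pi - (1 - \<alpha>) * pi)) = 0"
    by (simp_all only: cos_pi_half sin_pi_half)
  have \<alpha>: "\<alpha> = 1 / (4 * c)" and "c \<noteq> 0"
    using assms(1) by (simp_all add: c_def)
  \<comment> \<open>Numerator and denominator are divided by \<open>c\<^sup>2\<close>, with 1 /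
    \<open>c\<close> = 4 \<alpha>.\<close>
  have scale: "(c * C + t * S) / (c\<^sup>2 - t\<^sup>2) = 4 * \<alpha> / (1 - (4 * \<alpha> * t)\<^sup>2) * (C + 4 * \<alpha> * t * S)"
    for C S :: real
  proof -
    have "4 * \<alpha> = 1 / c" and "1 - (1 / c * t)\<^sup>2 = (c\<^sup>2 - t\<^sup>2) / c\<^sup>2"
      using \<open>c \<noteq> 0\<close> by (simp_all add: \<alpha> field_simps)
    \<comment> \<open>An arbitrary \<open>d\<close> stands for \<open>c\<^sup>2 - t\<^sup>2\<close>,
      so that the difference is not multiplied out. For \<open>d\<close> = 0 both sides are 0, by
      the convention for division by zero.\<close>
    moreover have "(c * C + t * S) / d = 1 / c / (d / c\<^sup>2) * (C + 1 / c * t * S)" for d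
      using \<open>c \<noteq> 0\<close> by (cases "d = 0") (simp_all add: field_simps power2_eq_square)
    ultimately show ?thesis
      by simp
  qed
  have "(1 - \<alpha>) * pi \<le> (1 + \<alpha>) * pi"
    using assms(1) by simp
  from has_integral_cos_mult_cos[OF this ne, where s = "(1 - \<alpha>) * pi"]
  have "((\<lambda>w. cos (c * (w - (1 - \<alpha>) * pi)) * cos (w * t)) has_integral
      (c * cos (pi * (1 + \<alpha>) * t) + t * sin (pi * (1 - \<alpha>) * t)) / (c\<^sup>2 - t\<^sup>2))
    {(1 - \<alpha>) * pi..(1 + \<alpha>) * pi}"
    unfolding ends by (simp add: add_divide_distrib mult_ac)
  then show ?thesis
    unfolding scale by (simp add: c_def)
qed

lemma has_integral_deO_spectrum_cos:
  fixes \<alpha> t :: real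
  assumes "0 < \<alpha>" and "\<alpha> < 1" and "t \<noteq> 1 / (4 * \<alpha>)" and "t \<noteq> - (1 / (4 * \<alpha>))"
  shows "((\<lambda>w. indicator {0..} w *\<^sub>R (deO_spectrum \<alpha> w * cos (w * t))) has_integral
    1 / sqrt (2 * pi) * ((1 - \<alpha>) * pi * Sinc ((1 - \<alpha>) * t) +
      4 * \<alpha> / (1 - (4 * \<alpha> * t)\<^sup>2) * (cos (pi * (1 + \<alpha>) * t) + 4 * \<alpha> * t * sin (pi * (1 - \<alpha>) * t)))) UNIV"
proof -
  \<comment> \<open>One integrand serves both pieces, so their integrals can be joined at (1 -
    \<alpha>) pi.\<close>
  let ?h = "\<lambda>w. cos (1 / (4 * \<alpha>) * max 0 (w - (1 - \<alpha>) * pi)) * cos (w * t)"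
  have "(?h has_integral (1 - \<alpha>) * pi * Sinc ((1 - \<alpha>) * t)) {0..(1 - \<alpha>) * pi}"
    by (rule has_integral_eq[OF _ has_integral_cos_Sinc]) (use assms in auto)
  moreover have "(?h has_integral 4 * \<alpha> / (1 - (4 * \<alpha> * t)\<^sup>2) *
      (cos (pi * (1 + \<alpha>) * t) + 4 * \<alpha> * t * sin (pi * (1 - \<alpha>) * t))) {(1 - \<alpha>) * pi..(1 + \<alpha>) * pi}"
    by (rule has_integral_eq[OF _ has_integral_rolloff]) (use assms in auto)
  ultimately have "(?h has_integral (1 - \<alpha>) * pi * Sinc ((1 - \<alpha>) * t) + 4 * \<alpha> / (1 - (4 * \<alpha> * t)\<^sup>2) *
      (cos (pi * (1 + \<alpha>) * t) + 4 * \<alpha> * t * sin (pi * (1 - \<alpha>) * t))) {0..(1 + \<alpha>) * pi}"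
    by (rule has_integral_combine[rotated 2]) (use assms in auto)
  from has_integral_mult_right[OF this, of "1 / sqrt (2 * pi)"]
  have "((\<lambda>w. if w \<in> {0..(1 + \<alpha>) * pi} then 1 / sqrt (2 * pi) * ?h w else 0) has_integral
      1 / sqrt (2 * pi) * ((1 - \<alpha>) * pi * Sinc ((1 - \<alpha>) * t) + 4 * \<alpha> / (1 - (4 * \<alpha> * t)\<^sup>2) *
      (cos (pi * (1 + \<alpha>) * t) + 4 * \<alpha> * t * sin (pi * (1 - \<alpha>) * t)))) UNIV"
    by (simp only: has_integral_restrict_UNIV)
  then show ?thesis
    unfolding deO_spectrum_half_line[OF assms(1,2), where g = "\<lambda>w. cos (w * t)"]
    by (rule has_integral_eq[rotated]) (simp add: indicator_def mult.assoc)
qed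

theorem mainTheorem3:
  fixes \<alpha> t :: real
  assumes "0 < \<alpha>" and "\<alpha> < 1"
    and "t \<noteq> 1 / (4 * \<alpha>)" and "t \<noteq> - (1 / (4 * \<alpha>))"
  shows "deO_scaling \<alpha> t = complex_of_real
    (1 / sqrt (2 * pi) * (1 - \<alpha>) * Sinc ((1 - \<alpha>) * t)
     + 1 / sqrt (2 * pi) * (4 * \<alpha> / pi) * (1 / (1 - (4 * \<alpha> * t)\<^sup>2))
       * (cos (pi * (1 + \<alpha>) * t) + 4 * \<alpha> * t * sin (pi * (1 - \<alpha>) * t)))"
proof -
  \<comment> \<open>\<open>J\<close> is the cosine integral over the half line. Evenness doubles it,
    and the 2 cancels against the factor 1 / (2 pi), which leaves \<open>J / pi\<close>.\<close>
  define J where "J = 1 / sqrt (2 * pi) * ((1 - \<alpha>) * pi * Sinc ((1 - \<alpha>) * t) +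
      4 * \<alpha> / (1 - (4 * \<alpha> * t)\<^sup>2) * (cos (pi * (1 + \<alpha>) * t) + 4 * \<alpha> * t * sin (pi * (1 - \<alpha>) * t)))"
  have int_cos: "integrable lborel (\<lambda>w. indicator {0..} w *\<^sub>R (deO_spectrum \<alpha> w * cos (w * t)))"
    and int_sin: "integrable lborel (\<lambda>w. indicator {0..} w *\<^sub>R (deO_spectrum \<alpha> w * sin (w * t)))"
    by (intro integrable_deO_spectrum_half_line assms continuous_intros)+
  \<comment> \<open>Integrability makes the Lebesgue integral a gauge integral as well, and
    uniqueness of the latter identifies its value.\<close>
  have "(LINT w|lborel. indicator {0..} w *\<^sub>R (deO_spectrum \<alpha> w * cos (w * t))) = J"
    using has_integral_integral_lborel[OF int_cos] has_integral_deO_spectrum_cos[OF assms]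
    unfolding J_def by (rule has_integral_unique)
  with int_cos have "has_bochner_integral lborel
      (\<lambda>w. indicator {0..} w *\<^sub>R (deO_spectrum \<alpha> w * cos (w * t))) J"
    by (simp only: has_bochner_integral_iff)
  then have cos_part: "has_bochner_integral lborel (\<lambda>w. deO_spectrum \<alpha> w * cos (w * t)) (2 *\<^sub>R J)"
    by (rule has_bochner_integral_even_function) simp
  \<comment> \<open>Only integrability on the half line is needed here, since the two halves cancel
    whatever their value.\<close>
  have sin_part: "has_bochner_integral lborel (\<lambda>w. deO_spectrum \<alpha> w * sin (w * t)) 0"
    by (rule has_bochner_integral_odd_function[OF has_bochner_integral_integrable[OF int_sin]]) simp
  have "has_bochner_integral lborel
      (\<lambda>w. complex_of_real (deO_spectrum \<alpha> w * cos (w * t)) +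
        \<i> * complex_of_real (deO_spectrum \<alpha> w * sin (w * t)))
      (complex_of_real (2 *\<^sub>R J) + \<i> * complex_of_real 0)"
    by (intro has_bochner_integral_add has_bochner_integral_mult_right
        has_bochner_integral_of_real cos_part sin_part)
  also have "(\<lambda>w. complex_of_real (deO_spectrum \<alpha> w * cos (w * t)) +
        \<i> * complex_of_real (deO_spectrum \<alpha> w * sin (w * t))) =
      (\<lambda>w. complex_of_real (deO_spectrum \<alpha> w) * exp (\<i> * complex_of_real (w * t)))"
    \<comment> \<open>The product \<open>w * t\<close> stays inside a single real embedding until
      sine and cosine have been moved to the reals.\<close>
    by (simp add: fun_eq_iff exp_Euler cos_of_real sin_of_real algebra_simps del: of_real_mult)
       (simp add: algebra_simps)
  finally have "deO_scaling \<alpha> t = complex_of_real (J / pi)"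
    unfolding deO_scaling_def inverse_fourier_def
    by (subst has_bochner_integral_integral_eq) (assumption, simp add: divide_simps)
  also have "J / pi = 1 / sqrt (2 * pi) * (1 - \<alpha>) * Sinc ((1 - \<alpha>) * t)
     + 1 / sqrt (2 * pi) * (4 * \<alpha> / pi) * (1 / (1 - (4 * \<alpha> * t)\<^sup>2))
       * (cos (pi * (1 + \<alpha>) * t) + 4 * \<alpha> * t * sin (pi * (1 - \<alpha>) * t))"
    unfolding J_def by (simp add: distrib_left add_divide_distrib mult_ac)
  finally show ?thesis .
qed

end
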